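(* A formula $f$ satisfies $AE(f)>1$ if and only if there exists a nice formula $g$ such that $g\preceq f$.
   Context: Variables are letters of an alphabet $\Delta=\{A,B,C,\dots\}$. A formula is a finite set of non-empty words over $\Delta$, called fragments, written separated by dots. A formula $g$ is nice if for every variable $X$ of $g$ there is a fragment of $g$ containing $X$ at least twice. An occurrence of a formula $f$ in a word $w$ over an alphabet $\Sigma$ is a non-erasing morphism $h:\Delta^*\to\Sigma^*$ such that $h(\phi)$ is a factor of $w$ for every fragment $\phi$ of $f$; $w$ avoids $f$ if it has no occurrence of $f$. We write $g\preceq f$ if there is a non-erasing morphism $h$ such that the $h$-image of every fragment of $g$ is a factor of some fragment of $f$. The exponent of a non-empty word $u$ is $|u|/p$ with $p$ the smallest period of $u$; a word is $\alpha$-free if it has no factor of exponent at least $\alpha$. The avoidability exponent $AE(f)$ is the largest (supremum) real $\alpha$ such that every $\alpha$-free word over any finite alphabet avoids $f$. *)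

theory Defs
  imports Complex_Main "HOL-Library.Sublist"
begin

text \<open>The alphabet of variables is countably infinite and is represented by \<^typ>\<open>nat\<close>.  A formula
  has at least one fragment: the empty set of fragments would vacuously be nice and would occur
  in every word.\<close>

definition formula :: "nat list set \<Rightarrow> bool" where
  "formula f \<longleftrightarrow> finite f \<and> f \<noteq> {} \<and> [] \<notin> f"

definition vars :: "nat list set \<Rightarrow> nat set" where
  "vars f = (\<Union>\<phi>\<in>f. set \<phi>)"

definition nice :: "nat list set \<Rightarrow> bool" where
  "nice g \<longleftrightarrow> (\<forall>X\<in>vars g. \<exists>\<phi>\<in>g. 2 \<le> count_list \<phi> X)"

text \<open>A morphism of free monoids is given by the images of the letters.\<close>

definition morph :: "('a \<Rightarrow> 'b list) \<Rightarrow> 'a list \<Rightarrow> 'b list" where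
  "morph h u = concat (map h u)"

definition nonerasing :: "'b set \<Rightarrow> ('a \<Rightarrow> 'b list) \<Rightarrow> bool" where
  "nonerasing \<Sigma> h \<longleftrightarrow> (\<forall>X. h X \<in> lists \<Sigma> \<and> h X \<noteq> [])"

definition occurrence :: "'b set \<Rightarrow> nat list set \<Rightarrow> 'b list \<Rightarrow> (nat \<Rightarrow> 'b list) \<Rightarrow> bool" where
  "occurrence \<Sigma> f w h \<longleftrightarrow> nonerasing \<Sigma> h \<and> (\<forall>\<phi>\<in>f. sublist (morph h \<phi>) w)"

definition avoids :: "'b set \<Rightarrow> 'b list \<Rightarrow> nat list set \<Rightarrow> bool" where
  "avoids \<Sigma> w f \<longleftrightarrow> \<not> (\<exists>h. occurrence \<Sigma> f w h)"

definition formula_le :: "nat list set \<Rightarrow> nat list set \<Rightarrow> bool" (infix "\<preceq>" 50) where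
  "g \<preceq> f \<longleftrightarrow> (\<exists>h. nonerasing UNIV h \<and> (\<forall>\<phi>\<in>g. \<exists>\<psi>\<in>f. sublist (morph h \<phi>) \<psi>))"

definition is_period :: "nat \<Rightarrow> 'b list \<Rightarrow> bool" where
  "is_period p u \<longleftrightarrow> 0 < p \<and> (\<forall>i. i + p < length u \<longrightarrow> u ! i = u ! (i + p))"

definition exponent :: "'b list \<Rightarrow> real" where
  "exponent u = real (length u) / real (LEAST p. is_period p u)"

definition alpha_free :: "real \<Rightarrow> 'b list \<Rightarrow> bool" where
  "alpha_free \<alpha> w \<longleftrightarrow> \<not> (\<exists>u. u \<noteq> [] \<and> sublist u w \<and> \<alpha> \<le> exponent u)"

text \<open>Letters are natural numbers, so that the alphabets range over all finite alphabets up to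
  renaming of letters.\<close>

definition AE_set :: "nat list set \<Rightarrow> real set" where
  "AE_set f = {\<alpha>. \<forall>\<Sigma> :: nat set. finite \<Sigma> \<longrightarrow>
     (\<forall>w\<in>lists \<Sigma>. alpha_free \<alpha> w \<longrightarrow> avoids \<Sigma> w f)}"

definition AE :: "nat list set \<Rightarrow> real" where
  "AE f = Sup (AE_set f)"

text \<open>The supremum above is taken over a non-empty set that is bounded above.\<close>

lemma period_props:
  assumes "u \<noteq> []"
  shows "0 < (LEAST p. is_period p u)" "(LEAST p. is_period p u) \<le> length u"
proof -
  have p: "is_period (length u) u" using assms by (auto simp: is_period_def)
  have "is_period (LEAST p. is_period p u) u" by (rule LeastI) (rule p)
  then show "0 < (LEAST p. is_period p u)"
    unfolding is_period_def[of "LEAST p. is_period p u"] by (rule conjunct1)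
  show "(LEAST p. is_period p u) \<le> length u" by (rule Least_le) (rule p)
qed

lemma exponent_bounds:
  assumes "u \<noteq> []"
  shows "1 \<le> exponent u" "exponent u \<le> real (length u)"
proof -
  define p where "p = (LEAST p. is_period p u)"
  have p: "1 \<le> real p" "real p \<le> real (length u)"
    using period_props[OF assms] by (auto simp: p_def)
  have e: "exponent u = real (length u) / real p" by (simp add: exponent_def p_def)
  show "1 \<le> exponent u" using p by (simp add: e)
  show "exponent u \<le> real (length u)"
    unfolding e using p(1) mult_left_mono[OF p(1), of "real (length u)"]
    by (simp add: divide_le_eq)
qed

lemma AE_set_one:
  assumes "formula f"
  shows "1 \<in> AE_set f"
  unfolding AE_set_def
proof (safe)
  fix \<Sigma> :: "nat set" and w :: "nat list" assume free: "alpha_free 1 w"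
  have w: "w = []"
  proof (rule ccontr)
    assume "w \<noteq> []"
    with exponent_bounds(1)[OF this] free show False by (auto simp: alpha_free_def)
  qed
  obtain \<phi> where \<phi>: "\<phi> \<in> f" "\<phi> \<noteq> []" using assms unfolding formula_def by blast
  show "avoids \<Sigma> w f"
    unfolding avoids_def
  proof
    assume "\<exists>h. occurrence \<Sigma> f w h"
    then obtain h where h: "occurrence \<Sigma> f w h" ..
    then have "\<forall>X. h X \<noteq> []" "morph h \<phi> = []"
      using \<phi>(1) w by (simp_all add: occurrence_def nonerasing_def)
    with \<phi> show False by (cases \<phi>) (auto simp: morph_def)
  qed
qed

lemma AE_set_bdd_above:
  assumes "formula f"
  shows "bdd_above (AE_set f)"
proof -
  obtain fs where fs: "set fs = f" using assms finite_list by (auto simp: formula_def)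
  define w where "w = concat fs"
  obtain \<phi>0 where \<phi>0: "\<phi>0 \<in> f" "\<phi>0 \<noteq> []" using assms unfolding formula_def by blast
  then have "hd \<phi>0 \<in> set w" using fs hd_in_set[of \<phi>0] unfolding w_def set_concat by blast
  then obtain x where x: "x \<in> set w" by blast
  define h where "h = (\<lambda>X. if X \<in> set w then [X] else [x])"
  have m: "morph h \<phi> = \<phi>" if "set \<phi> \<subseteq> set w" for \<phi>
    using that by (induction \<phi>) (auto simp: morph_def h_def)
  have s: "sublist \<phi> w" if "\<phi> \<in> f" for \<phi>
  proof -
    have "\<phi> \<in> set fs" using that fs by simp
    then obtain as bs where "fs = as @ \<phi> # bs" by (meson split_list)
    then have "w = concat as @ \<phi> @ concat bs" by (simp add: w_def)
    then show ?thesis unfolding sublist_def by blast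
  qed
  have "sublist (morph h \<phi>) w" if "\<phi> \<in> f" for \<phi>
    using s[OF that] m[OF set_mono_sublist[OF s[OF that]]] by simp
  moreover have "nonerasing (set w) h" using x by (simp add: nonerasing_def h_def)
  ultimately have occ: "occurrence (set w) f w h" by (simp add: occurrence_def)
  have "\<alpha> \<le> real (length w)" if "\<alpha> \<in> AE_set f" for \<alpha>
  proof (rule ccontr)
    assume neg: "\<not> ?thesis"
    have "exponent u < \<alpha>" if "u \<noteq> []" "sublist u w" for u
      using exponent_bounds(2)[OF that(1)] sublist_length_le[OF that(2)] neg by linarith
    then have "alpha_free \<alpha> w" by (fastforce simp: alpha_free_def)
    then have "avoids (set w) w f" using that by (auto simp: AE_set_def)
    with occ show False by (auto simp: avoids_def)
  qed
  then show ?thesis by (auto simp: bdd_above_def)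
qed

end

theory Submission
  imports Defs
begin

text \<open>If a nice formula \<open>g\<close> occurs, then the variable with the longest image appears twice in some
  fragment, and the factor between two such appearances has exponent at least \<open>1 + 1/m\<close>, where \<open>m\<close>
  is the maximal length of a fragment of \<open>g\<close>.

  Conversely, if no nice formula is below \<open>f\<close>, then some variable \<open>X\<close> appears at most once in every
  fragment. Splitting the fragments at \<open>X\<close> gives a formula with fewer variables, which by induction
  has images of exponents close to 1; mapping \<open>X\<close> to a very long word of fresh distinct letters
  creates no new factor of large exponent. The same kind of separator joins the images of the
  fragments into a single word.\<close>

section \<open>Morphisms and factors\<close>

lemma morph_simps [simp]:
  "morph h [] = []"
  "morph h (X # u) = h X @ morph h u"
  "morph h (u @ v) = morph h u @ morph h v"
  by (simp_all add: morph_def)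

lemma morph_singleton [simp]: "morph (\<lambda>X. [X]) u = u"
  by (induction u) auto

lemma morph_morph: "morph h (morph k u) = morph (\<lambda>X. morph h (k X)) u"
  by (induction u) auto

lemma morph_cong:
  assumes "\<And>X. X \<in> set u \<Longrightarrow> h X = k X"
  shows "morph h u = morph k u"
  using assms by (induction u) auto

lemma morph_in_lists:
  assumes "nonerasing \<Sigma> h"
  shows "morph h u \<in> lists \<Sigma>"
  using assms by (induction u) (auto simp: nonerasing_def)

lemma morph_eq_Nil_iff:
  assumes "nonerasing \<Sigma> h"
  shows "morph h u = [] \<longleftrightarrow> u = []"
  using assms by (cases u) (auto simp: nonerasing_def)

lemma sublist_morph:
  assumes "sublist u v"
  shows "sublist (morph h u) (morph h v)"
proof -
  obtain ps ss where "v = ps @ u @ ss" using assms by (auto simp: sublist_def)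
  then show ?thesis by simp
qed

lemma length_morph_le:
  assumes "\<And>X. X \<in> set u \<Longrightarrow> length (h X) \<le> M"
  shows "length (morph h u) \<le> length u * M"
  using assms
proof (induction u)
  case (Cons X u)
  then have "length (h X) \<le> M" "length (morph h u) \<le> length u * M" by auto
  then show ?case by simp
qed simp

lemma formula_le_trans_sublist:
  assumes "g \<preceq> f'" and "\<And>\<psi>. \<psi> \<in> f' \<Longrightarrow> \<exists>\<phi>\<in>f. sublist \<psi> \<phi>"
  shows "g \<preceq> f"
  using assms unfolding formula_le_def by (meson sublist_order.order.trans)

section \<open>Repetitions forced by nice formulas\<close>

lemma exponent_ge_of_period:
  assumes "is_period p u"
  shows "real (length u) / real p \<le> exponent u"
proof -
  have "(LEAST q. is_period q u) \<le> p" using assms by (rule Least_le)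
  moreover have "is_period (LEAST q. is_period q u) u" using assms by (rule LeastI)
  then have "0 < (LEAST q. is_period q u)" by (simp only: is_period_def[of "LEAST q. is_period q u"])
  ultimately show ?thesis unfolding exponent_def by (intro divide_left_mono) auto
qed

lemma is_period_overlap:
  assumes "x \<noteq> []"
  shows "is_period (length (x @ y)) (x @ y @ x)"
  using assms by (auto simp: is_period_def nth_append)

lemma count_list_ge_2E:
  assumes "2 \<le> count_list u x"
  obtains a b c where "u = a @ x # b @ x # c"
proof -
  have "x \<in> set u" using assms by (metis count_list_0_iff not_numeral_le_zero)
  then obtain a v where a: "u = a @ x # v" "x \<notin> set a" by (meson split_list_first)
  with assms have "count_list v x \<noteq> 0" by (simp add: count_list_0_iff[THEN iffD2])
  then have "x \<in> set v" by (metis count_list_0_iff)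
  then obtain b c where "v = b @ x # c" by (meson split_list)
  with a that show ?thesis by blast
qed

lemma nice_large_exponent:
  assumes "formula g" and "nice g"
  obtains \<alpha> where "\<alpha> > 1"
    and "\<And>\<Sigma> w. alpha_free \<alpha> w \<Longrightarrow> avoids \<Sigma> w g"
proof -
  define m where "m = Max (length ` g)"
  have m: "length \<phi> \<le> m" if "\<phi> \<in> g" for \<phi>
    using assms(1) that by (simp add: m_def formula_def)
  obtain \<phi>0 where "\<phi>0 \<in> g" "\<phi>0 \<noteq> []" using assms(1) by (auto simp: formula_def)
  then have m0: "m > 0" and vne: "vars g \<noteq> {}"
    using m[of \<phi>0] by (auto simp: vars_def intro: gr0I)
  have vfin: "finite (vars g)" using assms(1) by (simp add: vars_def formula_def)
  have "avoids \<Sigma> w g" if free: "alpha_free (1 + 1 / real m) w" for \<Sigma> and w :: "'a list"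
    unfolding avoids_def
  proof
    assume "\<exists>h. occurrence \<Sigma> g w h"
    then obtain h where ne: "\<And>X. h X \<noteq> []" and sub: "\<And>\<phi>. \<phi> \<in> g \<Longrightarrow> sublist (morph h \<phi>) w"
      by (auto simp: occurrence_def nonerasing_def)
    define M where "M = Max ((\<lambda>X. length (h X)) ` vars g)"
    have le: "length (h X) \<le> M" if "X \<in> vars g" for X
      using vfin that by (simp add: M_def)
    have "M \<in> (\<lambda>X. length (h X)) ` vars g" unfolding M_def using vfin vne by (intro Max_in) auto
    then obtain X where X: "X \<in> vars g" "length (h X) = M" by auto
    then obtain \<phi> where \<phi>: "\<phi> \<in> g" "2 \<le> count_list \<phi> X" using assms(2) by (auto simp: nice_def)
    obtain a b c where abc: "\<phi> = a @ X # b @ X # c" using count_list_ge_2E[OF \<phi>(2)] .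
    define u where "u = h X @ morph h b @ h X"
    define p where "p = length (h X @ morph h b)"
    have p0: "p > 0" using ne[of X] by (simp add: p_def)
    have "sublist u (morph h \<phi>)" unfolding u_def abc sublist_def
      by (rule exI[of _ "morph h a"], rule exI[of _ "morph h c"]) simp
    then have "sublist u w" using sub[OF \<phi>(1)] by (rule sublist_order.order.trans)
    moreover have "u \<noteq> []" using ne by (simp add: u_def)
    moreover have "1 + 1 / real m \<le> exponent u"
    proof -
      have "X' \<in> vars g" if "X' \<in> set b" for X'
        unfolding vars_def by (rule UN_I[OF \<phi>(1)]) (use that in \<open>simp add: abc\<close>)
      then have "length (morph h b) \<le> length b * M" using le by (intro length_morph_le) auto
      \<comment> \<open>The period \<open>p\<close> is the length of the image of
        \<open>X # b\<close>, which has at most \<open>m\<close> letters, each with an image of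
        length at most \<open>M\<close>. The excess of \<open>u\<close> over one period is exactly
        \<open>M\<close>, hence at least \<open>p / m\<close>.\<close>
      then have "p \<le> (length b + 1) * M" using X(2) by (simp add: p_def)
      also have "\<dots> \<le> m * M" using m[OF \<phi>(1)] by (intro mult_right_mono) (auto simp: abc)
      finally have "real p \<le> real m * real M" by (metis of_nat_le_iff of_nat_mult)
      then have "1 / real m \<le> real M / real p" using m0 p0 by (simp add: field_simps)
      moreover have "real (length u) = real p + real M" using X(2) by (simp add: u_def p_def)
      ultimately have "1 + 1 / real m \<le> real (length u) / real p"
        using p0 by (simp add: add_divide_distrib)
      also have "\<dots> \<le> exponent u"
        unfolding u_def p_def by (intro exponent_ge_of_period is_period_overlap ne)
      finally show ?thesis .
    qed
    ultimately show False using free by (auto simp: alpha_free_def)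
  qed
  with m0 that[of "1 + 1 / real m"] show ?thesis by simp
qed

text \<open>Composing an occurrence of \<open>f\<close> with the morphism that witnesses
  \<open>g \<preceq> f\<close> gives an occurrence of \<open>g\<close>.\<close>

lemma formula_le_avoids:
  assumes "g \<preceq> f" and "avoids \<Sigma> w g"
  shows "avoids \<Sigma> w f"
  unfolding avoids_def
proof
  assume "\<exists>h. occurrence \<Sigma> f w h"
  then obtain h where h: "nonerasing \<Sigma> h" "\<And>\<phi>. \<phi> \<in> f \<Longrightarrow> sublist (morph h \<phi>) w"
    by (auto simp: occurrence_def)
  obtain k where k: "nonerasing UNIV k" "\<And>\<phi>. \<phi> \<in> g \<Longrightarrow> \<exists>\<psi>\<in>f. sublist (morph k \<phi>) \<psi>"
    using assms(1) by (auto simp: formula_le_def)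
  have "nonerasing \<Sigma> (\<lambda>X. morph h (k X))"
    using k(1) morph_in_lists[OF h(1)] by (simp add: nonerasing_def morph_eq_Nil_iff[OF h(1)])
  moreover have "sublist (morph (\<lambda>X. morph h (k X)) \<phi>) w" if \<phi>: "\<phi> \<in> g" for \<phi>
  proof -
    obtain \<psi> where "\<psi> \<in> f" "sublist (morph k \<phi>) \<psi>" using k(2)[OF \<phi>] by blast
    then show ?thesis
      using h(2) sublist_morph[of "morph k \<phi>" \<psi> h] sublist_order.order.trans
      unfolding morph_morph by blast
  qed
  ultimately show False using assms(2) by (auto simp: avoids_def occurrence_def)
qed

section \<open>Separators of fresh letters\<close>

text \<open>Each letter of \<open>S\<close> appears only once in the whole word, so a repetition
  that meets both sides must have a period longer than \<open>S\<close>, while the part that it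
  repeats lies inside \<open>u\<close>. Hence \<open>S\<close> has to be long only in comparison
  with \<open>u\<close>, whatever the length of \<open>v\<close>.\<close>

lemma alpha_free_separated:
  assumes "\<alpha> > 1" and free: "alpha_free \<alpha> u" "alpha_free \<alpha> v"
    and S: "distinct S" "set S \<inter> set u = {}" "set S \<inter> set v = {}" "S \<noteq> []"
    and long: "real (length u) \<le> (\<alpha> - 1) * real (length S)"
  shows "alpha_free \<alpha> (u @ S @ v)"
  unfolding alpha_free_def
proof (safe)
  fix x assume x: "x \<noteq> []" "sublist x (u @ S @ v)" "\<alpha> \<le> exponent x"
  define W where "W = u @ S @ v"
  define p where "p = (LEAST p. is_period p x)"
  \<comment> \<open>The number of positions of \<open>x\<close> that are matched with a position
    \<open>p\<close> further on; an exponent of at least \<open>\<alpha>\<close> means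
    \<open>n \<ge> (\<alpha> - 1) * p\<close>.\<close>
  define n where "n = length x - p"
  obtain a b where ab: "W = a @ x @ b" using x(2) by (auto simp: sublist_def W_def)
  define i where "i = length a"
  let ?k = "length u" and ?s = "length S"
  have p: "p > 0" "p \<le> length x" using period_props[OF x(1)] by (auto simp: p_def)
  have per: "is_period p x" unfolding p_def
    by (rule LeastI[of _ "length x"]) (use x(1) in \<open>simp add: is_period_def\<close>)
  have "\<alpha> * real p \<le> real (length x)" using x(3) p(1) by (simp add: exponent_def p_def[symmetric] field_simps)
  then have n: "(\<alpha> - 1) * real p \<le> real n" using p(2) by (simp add: n_def of_nat_diff algebra_simps)
  moreover have "(\<alpha> - 1) * real p > 0" using assms(1) p(1) by simp
  ultimately have n0: "n > 0" by linarith
  have len: "i + n + p \<le> length W" using p(2) by (simp add: ab n_def i_def)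
  have rep: "W ! j = W ! (j + p)" if "i \<le> j" "j < i + n" for j
  proof -
    have "j - i < length x" "j - i + p < length x" using that n0 by (auto simp: n_def)
    with per have "x ! (j - i) = x ! (j - i + p)" by (simp add: is_period_def)
    then show ?thesis using that \<open>j - i < length x\<close> \<open>j - i + p < length x\<close>
      by (simp add: ab nth_append i_def)
  qed
  have uniq: "j = j'" if "W ! j = W ! j'" "?k \<le> j" "j < ?k + ?s" "j' < length W" for j j'
  proof -
    have "j - ?k < ?s" using that(2,3) by linarith
    with that(2) have Wj: "W ! j = S ! (j - ?k)" "j - ?k < ?s" by (simp_all add: W_def nth_append)
    then have inS: "W ! j' \<in> set S" using that(1) by (metis nth_mem)
    consider "j' < ?k" | "?k + ?s \<le> j'" | "?k \<le> j'" "j' < ?k + ?s" by linarith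
    then show ?thesis
    proof cases
      case 1
      then have "W ! j' \<in> set u" by (simp add: W_def nth_append)
      then show ?thesis using inS S(2) by auto
    next
      case 2
      then have "W ! j' = v ! (j' - ?k - ?s)" "j' - ?k - ?s < length v"
        using that(4) by (auto simp: W_def nth_append)
      then have "W ! j' \<in> set v" by simp
      then show ?thesis using inS S(3) by auto
    next
      case 3
      then have "j' - ?k < ?s" by linarith
      with 3 have "W ! j' = S ! (j' - ?k)" "j' - ?k < ?s" by (simp_all add: W_def nth_append)
      then have "j - ?k = j' - ?k" using Wj that(1) S(1) by (metis nth_eq_iff_index_eq)
      then show ?thesis using 3 that by simp
    qed
  qed
  \<comment> \<open>Two distinct positions with equal letters cannot involve the separator, so both
    ends of every matched pair avoid it.\<close>
  have out: "j < ?k \<or> ?k + ?s \<le> j" "j + p < ?k \<or> ?k + ?s \<le> j + p" if "i \<le> j" "j < i + n" for j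
    using uniq[of j "j + p"] uniq[of "j + p" j] rep[OF that] that len p(1) by force+
  have xW: "x = take (n + p) (drop i W)" using p(2) by (simp add: ab i_def n_def)
  have "\<not> i + n + p \<le> ?k"
  proof
    assume "i + n + p \<le> ?k"
    then have "x = take (n + p) (drop i u)" by (simp add: xW W_def)
    then have "sublist x u" by (simp add: sublist_order.order.trans[OF sublist_take sublist_drop])
    then show False using free(1) x by (auto simp: alpha_free_def)
  qed
  moreover have "\<not> ?k + ?s \<le> i"
  proof
    assume "?k + ?s \<le> i"
    then have "x = take (n + p) (drop (i - ?k - ?s) v)" by (simp add: xW W_def)
    then have "sublist x v" by (simp add: sublist_order.order.trans[OF sublist_take sublist_drop])
    then show False using free(2) x by (auto simp: alpha_free_def)
  qed
  \<comment> \<open>The matched positions form an interval that starts in \<open>u\<close>. It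
    cannot contain \<open>?k\<close>, the first position of \<open>S\<close>, so it stays in
    \<open>u\<close>. The partner of its last position cannot lie in \<open>u\<close>, as
    \<open>x\<close> would then be a factor of \<open>u\<close>; so it lies beyond \<open>S\<close>,
    which forces \<open>?s < p\<close>.\<close>
  moreover have "i < ?k" using out(1)[of i] n0 calculation(2) by simp
  moreover have "i + n \<le> ?k"
    using out(1)[of ?k] S(4) \<open>i < ?k\<close> by (cases "?k < i + n") auto
  moreover have "i + n - 1 + p < ?k \<or> ?k + ?s \<le> i + n - 1 + p"
    by (rule out(2)) (use n0 in linarith)+
  ultimately have "?s < p" "n \<le> ?k" using n0 by linarith+
  then have "(\<alpha> - 1) * real ?s < (\<alpha> - 1) * real p" using assms(1) by simp
  then show False using n long \<open>n \<le> ?k\<close> by linarith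
qed

text \<open>An interval of natural numbers above all of \<open>\<Sigma>\<close> provides as many
  fresh distinct letters as desired.\<close>

lemma separator_exists:
  fixes \<Sigma> :: "nat set" and \<alpha> :: real
  assumes "finite \<Sigma>" and "\<alpha> > 1"
  obtains S where "distinct S" "set S \<inter> \<Sigma> = {}" "S \<noteq> []" "real k \<le> (\<alpha> - 1) * real (length S)"
proof -
  obtain N where N: "\<And>x. x \<in> \<Sigma> \<Longrightarrow> x < N"
    using assms(1) by (meson finite_nat_set_iff_bounded)
  obtain l where l: "real k / (\<alpha> - 1) < real l" using reals_Archimedean2 by blast
  then have "real k < (\<alpha> - 1) * real l" using assms(2) by (simp add: field_simps)
  moreover from this have "0 < l" by (cases l) auto
  moreover have "set [N..<N + l] \<inter> \<Sigma> = {}" using N by fastforce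
  ultimately show ?thesis using that[of "[N..<N + l]"] by simp
qed

text \<open>The words are prepended one at a time, each followed by a separator whose length is
  adapted to the new word alone, so the growth of the word already built does no harm.\<close>

lemma alpha_free_join:
  fixes us :: "nat list list"
  assumes "\<alpha> > 1" and "\<And>u. u \<in> set us \<Longrightarrow> alpha_free \<alpha> u"
  shows "\<exists>w. alpha_free \<alpha> w \<and> (\<forall>u\<in>set us. sublist u w)"
  using assms(2)
proof (induction us)
  case Nil
  have "alpha_free \<alpha> []" by (simp add: alpha_free_def)
  then show ?case by auto
next
  case (Cons u us)
  then obtain w where w: "alpha_free \<alpha> w" "\<forall>u\<in>set us. sublist u w" by auto
  obtain S where S: "distinct S" "set S \<inter> (set u \<union> set w) = {}" "S \<noteq> []"
    "real (length u) \<le> (\<alpha> - 1) * real (length S)"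
    using separator_exists[OF _ assms(1), of "set u \<union> set w"] by auto
  have "alpha_free \<alpha> (u @ S @ w)"
    using S w Cons.prems by (intro alpha_free_separated[OF assms(1)]) auto
  moreover have "sublist w (u @ S @ w)" using sublist_append_leftI[of w "u @ S"] by (simp only: append_assoc)
  then have "\<forall>u'\<in>set (u # us). sublist u' (u @ S @ w)"
    using w(2) sublist_order.order.trans by auto
  ultimately show ?case by blast
qed

section \<open>Morphisms with images of small exponent\<close>

text \<open>Induction on the number of variables, with one morphism serving all fragments. Here
  \<open>f\<close> may contain the empty word, since splitting a fragment at a variable can produce
  it.\<close>

lemma alpha_free_images:
  assumes "finite f" and "\<alpha> > 1" and "\<And>g. formula g \<Longrightarrow> nice g \<Longrightarrow> \<not> g \<preceq> f"
  shows "\<exists>\<Sigma> h. finite \<Sigma> \<and> nonerasing \<Sigma> (h :: nat \<Rightarrow> nat list) \<and> (\<forall>\<phi>\<in>f. alpha_free \<alpha> (morph h \<phi>))"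
  using assms(1,3)
proof (induction "card (vars f)" arbitrary: f rule: less_induct)
  case less
  have vfin: "finite (vars f)" using less.prems(1) by (simp add: vars_def)
  show ?case
  proof (cases "vars f = {}")
    \<comment> \<open>All fragments are empty, so any non-erasing morphism works; the letter 0 is
      arbitrary.\<close>
    case True
    then have "\<forall>\<phi>\<in>f. \<phi> = []" by (auto simp: vars_def)
    then have "\<forall>\<phi>\<in>f. alpha_free \<alpha> (morph (\<lambda>_. [0::nat]) \<phi>)" by (auto simp: alpha_free_def)
    moreover have "nonerasing {0} (\<lambda>_. [0::nat])" by (simp add: nonerasing_def)
    ultimately show ?thesis by blast
  next
    case False
    \<comment> \<open>Without its empty words \<open>f\<close> is a formula, and it lies below
      \<open>f\<close> by the identity morphism. So it is not nice, which yields the variable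
      \<open>X\<close> to split at.\<close>
    have "formula (f - {[]})" using less.prems(1) False by (auto simp: formula_def vars_def)
    moreover have "f - {[]} \<preceq> f" unfolding formula_le_def
      by (rule exI[of _ "\<lambda>X. [X]"]) (auto simp: nonerasing_def)
    ultimately have "\<not> nice (f - {[]})" using less.prems(2) by blast
    then obtain X where X: "X \<in> vars f" "\<And>\<phi>. \<phi> \<in> f \<Longrightarrow> \<phi> \<noteq> [] \<Longrightarrow> count_list \<phi> X < 2"
      by (force simp: nice_def vars_def)
    \<comment> \<open>Taking all factors without \<open>X\<close> covers both the pieces around
      \<open>X\<close> and the fragments that avoid \<open>X\<close>. Since they are factors of
      fragments, no nice formula lies below \<open>f'\<close> either.\<close>
    define f' where "f' = {\<psi>. X \<notin> set \<psi> \<and> (\<exists>\<phi>\<in>f. sublist \<psi> \<phi>)}"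
    have "f' \<subseteq> (\<Union>\<phi>\<in>f. set (sublists \<phi>))" by (auto simp: f'_def)
    then have fin': "finite f'" using less.prems(1) by (auto intro: finite_subset)
    have "vars f' \<subseteq> vars f - {X}"
      using set_mono_sublist by (fastforce simp: vars_def f'_def)
    then have "card (vars f') < card (vars f)"
      using X(1) vfin by (intro psubset_card_mono) auto
    moreover have "\<not> g \<preceq> f'" if "formula g" "nice g" for g
    proof
      assume "g \<preceq> f'"
      then have "g \<preceq> f" by (rule formula_le_trans_sublist) (simp add: f'_def)
      with less.prems(2)[OF that] show False ..
    qed
    ultimately obtain \<Sigma> h where h: "finite \<Sigma>" "nonerasing \<Sigma> (h :: nat \<Rightarrow> nat list)"
      "\<And>\<phi>. \<phi> \<in> f' \<Longrightarrow> alpha_free \<alpha> (morph h \<phi>)"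
      using less.hyps[of f'] fin' by blast
    \<comment> \<open>A bound on the images of all pieces, so that a single separator suits every
      fragment.\<close>
    define k where "k = Max ((\<lambda>\<phi>. length (morph h \<phi>)) ` f')"
    have k: "length (morph h \<phi>) \<le> k" if "\<phi> \<in> f'" for \<phi> using that fin' by (simp add: k_def)
    obtain S where S: "distinct S" "set S \<inter> \<Sigma> = {}" "S \<noteq> []"
      "real k \<le> (\<alpha> - 1) * real (length S)"
      using separator_exists[OF h(1) assms(2)] .
    have disj: "set S \<inter> set (morph h \<psi>) = {}" for \<psi>
      using S(2) morph_in_lists[OF h(2), of \<psi>] by auto
    \<comment> \<open>As \<open>X\<close> does not occur in \<open>f'\<close>, its image can be
      replaced without affecting the images of the pieces.\<close>
    define h' where "h' = h(X := S)"
    have h'_eq: "morph h' \<psi> = morph h \<psi>" if "X \<notin> set \<psi>" for \<psi>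
      using that by (intro morph_cong) (auto simp: h'_def)
    have "alpha_free \<alpha> (morph h' \<phi>)" if \<phi>: "\<phi> \<in> f" for \<phi>
    proof (cases "X \<in> set \<phi>")
      case False
      then show ?thesis using h(3)[of \<phi>] \<phi> by (auto simp: h'_eq f'_def)
    next
      case True
      then obtain a b where ab: "\<phi> = a @ X # b" by (meson split_list)
      then have "count_list a X = 0" "count_list b X = 0" using X(2)[OF \<phi>] by auto
      then have nX: "X \<notin> set a" "X \<notin> set b" by (metis count_list_0_iff)+
      have "sublist b \<phi>" using sublist_append_leftI[of b "a @ [X]"] by (simp only: ab append_assoc append.simps)
      moreover have "sublist a \<phi>" by (simp add: ab)
      ultimately have f': "a \<in> f'" "b \<in> f'" using nX \<phi> by (auto simp: f'_def)
      have "real (length (morph h a)) \<le> (\<alpha> - 1) * real (length S)"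
        using k[OF f'(1)] S(4) by linarith
      then have "alpha_free \<alpha> (morph h a @ S @ morph h b)"
        using h(3) f' S disj by (intro alpha_free_separated[OF assms(2)]) auto
      moreover have "morph h' \<phi> = morph h a @ S @ morph h b"
        using nX by (simp add: ab h'_eq) (simp add: h'_def)
      ultimately show ?thesis by simp
    qed
    moreover have "nonerasing (\<Sigma> \<union> set S) h'"
      using h(2) S(3) by (auto simp: nonerasing_def h'_def)
    moreover have "finite (\<Sigma> \<union> set S)" using h(1) by simp
    ultimately show ?thesis by blast
  qed
qed

section \<open>Comparison of the avoidability exponent with 1\<close>

theorem theorem7:
  fixes f :: "nat list set"
  assumes "formula f"
  shows "AE f > 1 \<longleftrightarrow> (\<exists>g. formula g \<and> nice g \<and> g \<preceq> f)"
proof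
  assume "\<exists>g. formula g \<and> nice g \<and> g \<preceq> f"
  then obtain g where g: "formula g" "nice g" "g \<preceq> f" by blast
  obtain \<alpha> where \<alpha>: "\<alpha> > 1" "\<And>(\<Sigma> :: nat set) w. alpha_free \<alpha> w \<Longrightarrow> avoids \<Sigma> w g"
    using nice_large_exponent[OF g(1,2)] by blast
  then have "\<alpha> \<in> AE_set f" using formula_le_avoids[OF g(3)] by (auto simp: AE_set_def)
  then have "\<alpha> \<le> AE f" unfolding AE_def by (rule cSup_upper) (rule AE_set_bdd_above[OF assms])
  with \<alpha>(1) show "AE f > 1" by simp
next
  assume AE: "AE f > 1"
  show "\<exists>g. formula g \<and> nice g \<and> g \<preceq> f"
  proof (rule ccontr)
    assume none: "\<not> ?thesis"
    \<comment> \<open>Any member above 1 would be refuted by one \<open>\<alpha>\<close>-free word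
      in which \<open>f\<close> occurs.\<close>
    have "\<alpha> \<le> 1" if \<alpha>: "\<alpha> \<in> AE_set f" for \<alpha>
    proof (rule ccontr)
      assume "\<not> \<alpha> \<le> 1"
      then have gt: "\<alpha> > 1" by simp
      have fin: "finite f" using assms by (simp add: formula_def)
      obtain \<Sigma> h where h: "finite \<Sigma>" "nonerasing \<Sigma> (h :: nat \<Rightarrow> nat list)"
        "\<And>\<phi>. \<phi> \<in> f \<Longrightarrow> alpha_free \<alpha> (morph h \<phi>)"
        using alpha_free_images[OF fin gt] none by blast
      obtain fs where fs: "set fs = f" using fin finite_list by blast
      obtain w where w: "alpha_free \<alpha> w" "\<And>\<phi>. \<phi> \<in> f \<Longrightarrow> sublist (morph h \<phi>) w"
        using alpha_free_join[OF gt, of "map (morph h) fs"] h(3) fs by auto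
      \<comment> \<open>The alphabet is enlarged because the separators in \<open>w\<close> may use
        letters outside \<open>\<Sigma>\<close>.\<close>
      have "nonerasing (\<Sigma> \<union> set w) h" using h(2) by (auto simp: nonerasing_def)
      then have "occurrence (\<Sigma> \<union> set w) f w h" using w(2) by (simp add: occurrence_def)
      moreover have "avoids (\<Sigma> \<union> set w) w f"
        using \<alpha> w(1) h(1) by (auto simp: AE_set_def)
      ultimately show False by (auto simp: avoids_def)
    qed
    then have "AE f \<le> 1" unfolding AE_def using AE_set_one[OF assms] by (intro cSup_least) auto
    with AE show False by simp
  qed
qed

end
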